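(* Let $T_n$ be a tree on $n \ge 2$ vertices. Then $\textrm{RED:LD}(T_n) \ge \lceil (2n+2)/3 \rceil$.
   Context: $N(v)$ denotes the open neighborhood of $v$. A set $S \subseteq V(G)$ is a locating-dominating (LD) set if for all $u,v \in V(G)-S$: $N(v)\cap S \neq \varnothing$, and if $u \ne v$ then $N(v) \cap S \neq N(u) \cap S$. A RED:LD set is an LD set $S$ such that $S-\{v\}$ is an LD set for every $v \in S$. $\textrm{RED:LD}(G)$ is the minimum cardinality of a RED:LD set of $G$. *)

theory Defs
  imports Complex_Main "Graph_Theory.Graph_Theory"
begin

text \<open>
  Finite simple graphs are the symmetric digraphs of locale \<^locale>\<open>graph\<close>.  The constant
  \<^const>\<open>tree\<close> of the library excludes every directed cycle, including the closed walk
  $a, b, a$ along a single edge, and so no symmetric digraph with an edge satisfies it.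
  A cycle of the undirected graph is a directed cycle with at least three arcs.
\<close>

definition undirected_tree :: "('a, 'b) pre_digraph \<Rightarrow> bool" where
  "undirected_tree G \<longleftrightarrow>
     graph G \<and> Digraph_Component.connected G \<and>
     \<not> (\<exists>p. pre_digraph.cycle G p \<and> length p \<ge> 3)"

definition open_neighborhood :: "('a, 'b) pre_digraph \<Rightarrow> 'a \<Rightarrow> 'a set" where
  "open_neighborhood G v = {u. v \<rightarrow>\<^bsub>G\<^esub> u}"

definition LD_set :: "('a, 'b) pre_digraph \<Rightarrow> 'a set \<Rightarrow> bool" where
  "LD_set G S \<longleftrightarrow>
     S \<subseteq> verts G \<and>
     (\<forall>u \<in> verts G - S. \<forall>v \<in> verts G - S.
        open_neighborhood G v \<inter> S \<noteq> {} \<and>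
        (u \<noteq> v \<longrightarrow> open_neighborhood G v \<inter> S \<noteq> open_neighborhood G u \<inter> S))"

definition RED_LD_set :: "('a, 'b) pre_digraph \<Rightarrow> 'a set \<Rightarrow> bool" where
  "RED_LD_set G S \<longleftrightarrow> LD_set G S \<and> (\<forall>v \<in> S. LD_set G (S - {v}))"

text \<open>
  The minimum below is unspecified for graphs without a RED:LD set, that is, for graphs with an
  isolated vertex.
\<close>

definition RED_LD :: "('a, 'b) pre_digraph \<Rightarrow> nat" where
  "RED_LD G = (LEAST k. \<exists>S. RED_LD_set G S \<and> card S = k)"

lemma RED_LD_set_verts:
  assumes "graph G" and "\<And>v. v \<in> verts G \<Longrightarrow> open_neighborhood G v \<noteq> {}"
  shows "RED_LD_set G (verts G)"
proof -
  interpret graph G by fact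
  have "open_neighborhood G v \<inter> (verts G - {v}) \<noteq> {}" if "v \<in> verts G" for v
    using assms(2)[OF that] adj_in_verts(2) adj_not_same
    by (fastforce simp: open_neighborhood_def)
  then show ?thesis
    by (auto simp: RED_LD_set_def LD_set_def)
qed

lemma undirected_tree_RED_LD_set:
  assumes "undirected_tree G" and "card (verts G) \<ge> 2"
  shows "RED_LD_set G (verts G)"
proof (rule RED_LD_set_verts)
  show G: "graph G" using assms(1) by (simp add: undirected_tree_def)
  interpret graph G by fact
  fix v assume v: "v \<in> verts G"
  have "verts G \<noteq> {v}" using assms(2) by auto
  then obtain w where w: "w \<in> verts G" "w \<noteq> v" using v by blast
  have "v \<rightarrow>\<^sup>*\<^bsub>mk_symmetric G\<^esub> w"
    using assms(1) v w unfolding undirected_tree_def Digraph_Component.connected_def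
    by (auto simp: strongly_connected_def)
  then have "v \<rightarrow>\<^sup>*\<^bsub>G\<^esub> w" using reachable_mk_symmetric_eq[OF sym_arcs] by simp
  then obtain x where "v \<rightarrow>\<^bsub>G\<^esub> x"
    using w(2) by (cases rule: converse_reachable_cases) auto
  then show "open_neighborhood G v \<noteq> {}" by (auto simp: open_neighborhood_def)
qed

end

theory Submission
  imports Defs
begin

text \<open>
  Redundancy forces every vertex outside a RED:LD set \<open>S\<close> to have at least two neighbours in \<open>S\<close>
  and every vertex of \<open>S\<close> to have at least one; the separation condition plays no role.  Hence a
  graph with \<open>n\<close> vertices and a RED:LD set of size \<open>k\<close> has at least \<open>2 (n - k) + k / 2\<close> edges.
  A tree has \<open>n - 1\<close> edges, and comparing the two counts gives \<open>3 k \<ge> 2 n + 2\<close>.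
\<close>

text \<open>Take a longest path inside \<open>W\<close>. By maximality every neighbour in
  \<open>W\<close> of its first vertex lies on the path. One of them differs from the second vertex
  of the path, and the edge back from it closes a cycle.\<close>

lemma (in graph) ex_cycle_of_min_degree_two:
  assumes W: "W \<subseteq> verts G" "W \<noteq> {}"
    and deg: "\<And>u. u \<in> W \<Longrightarrow> 2 \<le> card {w \<in> W. u \<rightarrow>\<^bsub>G\<^esub> w}"
  shows "\<exists>p. cycle p \<and> 3 \<le> length p"
proof -
  \<comment> \<open>Start, arc list and end are packed into one triple so that a path of greatest
    length can be chosen; path lengths are bounded by \<open>card (verts G)\<close>.\<close>
  define P where "P = (\<lambda>(u, p, v). apath u p v \<and> set (awalk_verts u p) \<subseteq> W)"
  obtain x where "x \<in> W" using W by blast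
  then have "P (x, [], x)" using W by (auto simp: P_def apath_Nil_iff)
  moreover have "\<forall>t. P t \<longrightarrow> length (fst (snd t)) < card (verts G)"
    using length_apath_less by (auto simp: P_def)
  ultimately have "\<exists>t. P t \<and> (\<forall>t'. P t' \<longrightarrow> length (fst (snd t')) \<le> length (fst (snd t)))"
    by (rule ex_has_greatest_nat)
  then obtain u p v where "P (u, p, v)"
    and "\<forall>t'. P t' \<longrightarrow> length (fst (snd t')) \<le> length p" by auto
  then have p: "apath u p v" "set (awalk_verts u p) \<subseteq> W"
    and longest: "\<And>u' p' v'. apath u' p' v' \<Longrightarrow> set (awalk_verts u' p') \<subseteq> W
      \<Longrightarrow> length p' \<le> length p"
    by (auto simp: P_def)
  have "u \<in> W" using p hd_in_awalk_verts by blast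
  have nbr_on_path: "w \<in> set (awalk_verts u p)" if "w \<in> W" "u \<rightarrow>\<^bsub>G\<^esub> w" for w
  proof (rule ccontr)
    assume w: "w \<notin> set (awalk_verts u p)"
    have "w \<rightarrow>\<^bsub>G\<^esub> u" using that(2) arcs_ends_symmetric[OF sym_arcs] by blast
    then obtain e where e: "e \<in> arcs G" "tail G e = w" "head G e = u" by auto
    then have "apath w (e # p) v" using p w by (simp add: apath_Cons_iff)
    moreover have "set (awalk_verts w (e # p)) \<subseteq> W" using e p that by simp
    ultimately show False using longest by fastforce
  qed
  \<comment> \<open>Avoiding the successor of \<open>u\<close> on \<open>p\<close> rules out the
    closed walk that runs along a single edge and back.\<close>
  obtain w where w: "w \<in> W" "u \<rightarrow>\<^bsub>G\<^esub> w" "p \<noteq> [] \<longrightarrow> w \<noteq> head G (hd p)"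
  proof -
    have "\<not> {w \<in> W. u \<rightarrow>\<^bsub>G\<^esub> w} \<subseteq> {head G (hd p)}"
    proof
      assume "{w \<in> W. u \<rightarrow>\<^bsub>G\<^esub> w} \<subseteq> {head G (hd p)}"
      from card_mono[OF _ this] show False using deg[OF \<open>u \<in> W\<close>] by simp
    qed
    then show thesis using that by blast
  qed
  have "w \<noteq> u" using w(2) adj_not_same by blast
  have awp: "awalk u p v" "distinct (awalk_verts u p)" using p by (auto simp: apath_def)
  obtain q r where qr: "p = q @ r" "awalk u q w" "awalk w r v"
    using awalk_decomp[OF awp(1) nbr_on_path[OF w(1,2)]] by blast
  have dist: "distinct (awalk_verts u q)"
    using awp qr by (auto simp: awalk_verts_append)
  have "q \<noteq> []" using qr \<open>w \<noteq> u\<close> by (auto simp: awalk_Nil_iff)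
  \<comment> \<open>A single arc would make \<open>w\<close> the head of the first arc of
    \<open>p\<close>, which the choice of \<open>w\<close> excludes.\<close>
  moreover have "q \<noteq> [a]" for a
  proof
    assume "q = [a]"
    then show False using qr w(3) by (auto simp: awalk_simps)
  qed
  ultimately have len: "2 \<le> length q"
    by (cases q; cases "tl q") auto
  have "w \<rightarrow>\<^bsub>G\<^esub> u" using w(2) arcs_ends_symmetric[OF sym_arcs] by blast
  then obtain e where e: "e \<in> arcs G" "tail G e = w" "head G e = u" by auto
  have "awalk w [e] u" using e wellformed by (auto simp: awalk_simps)
  then have closed: "awalk u (q @ [e]) u" using qr(2) by (rule awalk_appendI[rotated])
  have verts: "awalk_verts u (q @ [e]) = awalk_verts u q @ [u]"
    using awalk_verts_append[OF closed] e by simp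
  obtain ys where ys: "awalk_verts u q = u # ys"
    using awhd_of_awalk[OF qr(2)] by (cases "awalk_verts u q") auto
  \<comment> \<open>The list is \<open>u # ys @ [u]\<close>; dropping its head leaves
    \<open>u\<close> only at the end, and \<open>u\<close> is not in \<open>ys\<close>.\<close>
  have "distinct (tl (awalk_verts u (q @ [e])))"
    using dist verts ys by simp
  then have "cycle (q @ [e])" using closed by (auto simp: cycle_def)
  then show ?thesis using len by (intro exI[of _ "q @ [e]"]) simp
qed

text \<open>Each edge contributes two ordered pairs to \<^term>\<open>arcs_ends G\<close>, whence the factor 2.\<close>

lemma (in graph) card_induced_adjacency_le:
  assumes acyclic: "\<not> (\<exists>p. cycle p \<and> 3 \<le> length p)"
    and "W \<subseteq> verts G" "W \<noteq> {}"
  shows "card (arcs_ends G \<inter> W \<times> W) + 2 \<le> 2 * card W"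
proof -
  have "finite W" using assms(2) finite_verts finite_subset by blast
  then show ?thesis using assms(2,3)
  proof (induction W rule: finite_psubset_induct)
    case (psubset W)
    \<comment> \<open>Without long cycles some vertex is a leaf or isolated within \<open>W\<close>.
      Deleting it loses at most two ordered pairs, while the right-hand side drops by exactly
      two.\<close>
    obtain u where u: "u \<in> W" "card {w \<in> W. u \<rightarrow>\<^bsub>G\<^esub> w} \<le> 1"
      using ex_cycle_of_min_degree_two[OF psubset.prems] acyclic by force
    let ?N = "{w \<in> W. u \<rightarrow>\<^bsub>G\<^esub> w}"
    let ?W = "W - {u}"
    have "v \<rightarrow>\<^bsub>G\<^esub> w \<Longrightarrow> w \<rightarrow>\<^bsub>G\<^esub> v" for v w
      using arcs_ends_symmetric[OF sym_arcs] by blast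
    then have split:
      "arcs_ends G \<inter> W \<times> W \<subseteq> (arcs_ends G \<inter> ?W \<times> ?W) \<union> {u} \<times> ?N \<union> ?N \<times> {u}"
      by auto
    have fin: "finite ?W" "finite ?N" using psubset.hyps by auto
    have "card (arcs_ends G \<inter> W \<times> W)
        \<le> card ((arcs_ends G \<inter> ?W \<times> ?W) \<union> {u} \<times> ?N \<union> ?N \<times> {u})"
      using fin by (intro card_mono[OF _ split]) blast
    also have "\<dots> \<le> card (arcs_ends G \<inter> ?W \<times> ?W) + card ({u} \<times> ?N) + card (?N \<times> {u})"
      by (meson add_mono card_Un_le le_refl le_trans)
    also have "\<dots> = card (arcs_ends G \<inter> ?W \<times> ?W) + 2 * card ?N"
      by (simp add: card_cartesian_product)
    finally have step:
      "card (arcs_ends G \<inter> W \<times> W) \<le> card (arcs_ends G \<inter> ?W \<times> ?W) + 2 * card ?N" .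
    have card_W: "card W = Suc (card ?W)"
      using card.remove[OF _ u(1)] psubset.hyps by blast
    show ?case
    proof (cases "?W = {}")
      \<comment> \<open>The induction hypothesis needs a nonempty set, so a singleton is treated
        directly: there are no loops, and the bound is \<open>0 + 2 \<le> 2 * 1\<close>.\<close>
      case True
      then have "?N = {}" using u(1) adj_not_same by blast
      moreover have "arcs_ends G \<inter> ?W \<times> ?W = {}" using True by blast
      ultimately have "card (arcs_ends G \<inter> W \<times> W) = 0" 
        using step by (simp only: card.empty)
      then show ?thesis using card_W by simp
    next
      case False
      have "card (arcs_ends G \<inter> ?W \<times> ?W) + 2 \<le> 2 * card ?W"
        using psubset.IH[of ?W] psubset.prems u(1) False by blast
      then show ?thesis using step u(2) card_W by linarith
    qed
  qed
qed

text \<open>Once \<open>v\<close> is removed from \<open>S\<close>, it lies outside and must itself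
  be dominated by the rest.\<close>

lemma RED_LD_set_nbrs_nonempty:
  assumes "RED_LD_set G S" "v \<in> S"
  shows "open_neighborhood G v \<inter> S \<noteq> {}"
proof -
  have "S \<subseteq> verts G" "LD_set G (S - {v})"
    using assms by (simp_all add: RED_LD_set_def LD_set_def)
  then have "open_neighborhood G v \<inter> (S - {v}) \<noteq> {}"
    using assms(2) unfolding LD_set_def by blast
  then show ?thesis by blast
qed

text \<open>Some \<open>s\<close> in \<open>S\<close> dominates \<open>v\<close>; after removing
  \<open>s\<close>, a second vertex \<open>t\<close> must still do so.\<close>

lemma RED_LD_set_card_nbrs_ge_2:
  assumes "RED_LD_set G S" "v \<in> verts G - S" "finite S"
  shows "2 \<le> card (open_neighborhood G v \<inter> S)"
proof -
  have "LD_set G S" using assms(1) by (simp add: RED_LD_set_def)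
  then obtain s where s: "s \<in> open_neighborhood G v \<inter> S"
    using assms(2) unfolding LD_set_def by blast
  then have "LD_set G (S - {s})" using assms(1) by (auto simp: RED_LD_set_def)
  then have "open_neighborhood G v \<inter> (S - {s}) \<noteq> {}"
    using assms(2) by (auto simp: LD_set_def)
  then obtain t where t: "t \<in> open_neighborhood G v \<inter> S" "t \<noteq> s" by blast
  have "card {s, t} \<le> card (open_neighborhood G v \<inter> S)"
    using assms(3) s t by (intro card_mono) auto
  then show ?thesis using t by simp
qed

text \<open>Ordered pairs leading out of \<open>S\<close>, into \<open>S\<close> and within
  \<open>S\<close> are pairwise disjoint. Each outside vertex accounts for at least two into
  \<open>S\<close> and their two reversals, each vertex of \<open>S\<close> for at least one within
  \<open>S\<close>.\<close>

lemma (in graph) RED_LD_set_card_adjacency_ge: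
  assumes S: "RED_LD_set G S"
  shows "4 * (card (verts G) - card S) + card S \<le> card (arcs_ends G)"
proof -
  have sub: "S \<subseteq> verts G" using S by (simp add: RED_LD_set_def LD_set_def)
  then have fin: "finite S" "finite (verts G - S)" using finite_subset[OF _ finite_verts] by auto
  let ?N = "\<lambda>v. open_neighborhood G v \<inter> S"
  let ?A = "Sigma (verts G - S) ?N" and ?B = "Sigma S ?N"
  have finA: "finite ?A" and finB: "finite ?B" using fin by auto
  have "card (verts G - S) * 2 \<le> (\<Sum>v\<in>verts G - S. card (?N v))"
    using sum_bounded_below[of "verts G - S" 2 "\<lambda>v. card (?N v)"]
      RED_LD_set_card_nbrs_ge_2[OF S _ fin(1)] by simp
  then have A: "2 * (card (verts G) - card S) \<le> card ?A"
    using fin by (simp add: card_Diff_subset[OF _ sub])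
  have "1 \<le> card (?N v)" if "v \<in> S" for v
    using RED_LD_set_nbrs_nonempty[OF S that] fin(1) by (simp add: Suc_le_eq card_gt_0_iff)
  then have "card S * 1 \<le> (\<Sum>v\<in>S. card (?N v))"
    using sum_bounded_below[of S 1 "\<lambda>v. card (?N v)"] by simp
  then have B: "card S \<le> card ?B" using fin by simp
  have "v \<rightarrow>\<^bsub>G\<^esub> w \<Longrightarrow> w \<rightarrow>\<^bsub>G\<^esub> v" for v w
    using arcs_ends_symmetric[OF sym_arcs] by blast
  then have "?A \<union> ?A\<inverse> \<union> ?B \<subseteq> arcs_ends G" by (auto simp: open_neighborhood_def)
  then have "card (?A \<union> ?A\<inverse> \<union> ?B) \<le> card (arcs_ends G)"
    by (intro card_mono) (auto simp: arcs_ends_def)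
  moreover have "card (?A \<union> ?A\<inverse> \<union> ?B) = card ?A + card (?A\<inverse>) + card ?B"
    using finA finB by (subst card_Un_disjoint; (subst card_Un_disjoint)?) auto
  moreover have "card (?A\<inverse>) = card ?A" by (rule card_inverse)
  ultimately show ?thesis using A B by linarith
qed

lemma undirected_tree_RED_LD_set_card_ge:
  assumes T: "undirected_tree T" and "verts T \<noteq> {}" and S: "RED_LD_set T S"
  shows "2 * card (verts T) + 2 \<le> 3 * card S"
proof -
  interpret graph T using T by (simp add: undirected_tree_def)
  have "arcs_ends T \<inter> verts T \<times> verts T = arcs_ends T"
    using adj_in_verts by auto
  then have "card (arcs_ends T) + 2 \<le> 2 * card (verts T)"
    using card_induced_adjacency_le[of "verts T"] T assms(2) by (simp add: undirected_tree_def)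
  \<comment> \<open>This makes the truncated difference \<open>card (verts T) - card S\<close> a
    true one, so that \<open>4 * (n - k) + k \<le> 2 * n - 2\<close> rearranges to the
    claim.\<close>
  moreover have "card S \<le> card (verts T)"
    using S by (intro card_mono) (auto simp: RED_LD_set_def LD_set_def)
  ultimately show ?thesis using RED_LD_set_card_adjacency_ge[OF S] by linarith
qed

theorem theorem8:
  fixes T :: "('a, 'b) pre_digraph" and n :: nat
  assumes "undirected_tree T"
    and "card (verts T) = n"
    and "n \<ge> 2"
  shows "int (RED_LD T) \<ge> \<lceil>(2 * real n + 2) / 3\<rceil>"
proof -
  \<comment> \<open>The full vertex set is a witness, so the \<open>LEAST\<close> in
    \<open>RED_LD\<close> is attained by some \<open>S\<close>.\<close>
  have "\<exists>k S. RED_LD_set T S \<and> card S = k"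
    using undirected_tree_RED_LD_set assms by blast
  then obtain S where S: "RED_LD_set T S" "card S = RED_LD T"
    unfolding RED_LD_def by (rule LeastI_ex[elim_format]) blast
  have "verts T \<noteq> {}" using assms(2,3) by auto
  then have "2 * n + 2 \<le> 3 * RED_LD T"
    using undirected_tree_RED_LD_set_card_ge[OF assms(1) _ S(1)] assms(2) S(2) by simp
  then show ?thesis by (simp add: ceiling_le_iff)
qed

end
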